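(* Let $c\in[0,1)$, $\sigma>1$ and $t\in\mathbb{R}$. If $-\cos(t\log 2)\ge 2^{\sigma}\zeta(\sigma)-2^{\sigma}-1$, then $\eta(\sigma+it)-c\neq 0$.
   Context: $\zeta$ is the Riemann zeta function and $\eta(s)=\sum_{n\ge 1}(-1)^{n+1}n^{-s}$ ($\Re(s)>0$) is the Euler (Dirichlet) eta function. *)

theory Defs
  imports "HOL-Analysis.Analysis"
begin

text \<open>
  The Dirichlet series of the Riemann zeta function. It represents \<open>\<zeta>(s)\<close> exactly when
  \<open>Re s > 1\<close>; no analytic continuation is provided, so the value is meaningless elsewhere.
  The summation index is shifted: the term at \<open>n\<close> belongs to the positive integer \<open>Suc n\<close>.
\<close>
definition riemann_zeta :: "complex \<Rightarrow> complex" where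
  "riemann_zeta s = (\<Sum>n. of_nat (Suc n) powr (- s))"

text \<open>
  The sum is taken in the order of the index, so it also covers the strip \<open>0 < Re s \<le> 1\<close>,
  where convergence is only conditional. For \<open>Re s \<le> 0\<close> the value is meaningless.
\<close>
definition dirichlet_eta :: "complex \<Rightarrow> complex" where
  "dirichlet_eta s = (\<Sum>n. (-1) ^ (Suc n + 1) * of_nat (Suc n) powr (- s))"

lemma riemann_zeta_of_real:
  assumes "\<sigma> > 1"
  shows "riemann_zeta (complex_of_real \<sigma>) = complex_of_real (\<Sum>n. real (Suc n) powr (- \<sigma>))"
proof -
  have "summable (\<lambda>n. real n powr (- \<sigma>))"
    using assms by (simp add: summable_real_powr_iff)
  then have "summable (\<lambda>n. real (Suc n) powr (- \<sigma>))"
    by (subst summable_Suc_iff)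
  then have "complex_of_real (\<Sum>n. real (Suc n) powr (- \<sigma>))
      = (\<Sum>n. complex_of_real (real (Suc n) powr (- \<sigma>)))"
    by (rule suminf_of_real)
  also have "(\<lambda>n. complex_of_real (real (Suc n) powr (- \<sigma>)))
      = (\<lambda>n. of_nat (Suc n) powr (- complex_of_real \<sigma>))"
  proof
    fix n
    show "complex_of_real (real (Suc n) powr (- \<sigma>)) = of_nat (Suc n) powr (- complex_of_real \<sigma>)"
      using powr_of_real[of "real (Suc n)" "- \<sigma>"] by simp
  qed
  finally show ?thesis
    by (simp add: riemann_zeta_def)
qed

end

theory Submission imports Defs
begin

text \<open>
  The hypothesis forces \<open>Re \<eta>(\<sigma> + it) \<ge> 1\<close>, so \<open>\<eta>\<close> cannot take a value \<open>c < 1\<close>. In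
  \<open>\<eta>(s) = 1 - 2\<^sup>-\<^sup>s + 3\<^sup>-\<^sup>s - \<dots>\<close> the first two terms have real part
  \<open>1 - 2\<^sup>-\<^sup>\<sigma> cos (t log 2)\<close>, and the terms from \<open>3\<^sup>-\<^sup>s\<close> on can lower this by at most the sum of
  their absolute values, which is \<open>\<zeta>(\<sigma>) - 1 - 2\<^sup>-\<^sup>\<sigma>\<close>. Divided by \<open>2\<^sup>\<sigma>\<close>, the hypothesis says
  exactly that \<open>- 2\<^sup>-\<^sup>\<sigma> cos (t log 2)\<close> makes up for that loss.
\<close>

lemma norm_of_nat_powr_complex:
  "norm (of_nat (Suc n) powr (- s) :: complex) = real (Suc n) powr (- Re s)"
  using norm_powr_real_powr[of "of_nat (Suc n)" "- s"] by simp

lemma Re_two_powr_minus: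
  "Re (2 powr (- Complex \<sigma> t)) = 2 powr (- \<sigma>) * cos (t * ln 2)"
proof -
  have "Ln 2 = complex_of_real (ln 2)"
    using Ln_of_real[of 2] by simp
  then show ?thesis
    by (simp add: powr_def Re_exp)
qed

lemma summable_Suc_powr_minus:
  assumes "(\<sigma>::real) > 1"
  shows "summable (\<lambda>n. real (Suc n) powr (- \<sigma>))"
  using assms by (subst summable_Suc_iff) (simp add: summable_real_powr_iff)

text \<open>
  For \<open>Re s > 1\<close> the series of \<open>\<eta>(s)\<close> is dominated termwise by that of \<open>\<zeta>(\<sigma>)\<close>, so splitting off
  the first two terms of both leaves comparable tails.
\<close>
lemma Re_dirichlet_eta_ge:
  assumes "\<sigma> > 1"
  shows "Re (dirichlet_eta (Complex \<sigma> t)) \<ge>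
    1 - 2 powr (- \<sigma>) * cos (t * ln 2)
      - (Re (riemann_zeta (complex_of_real \<sigma>)) - 1 - 2 powr (- \<sigma>))"
proof -
  define f where "f n = (-1) ^ (Suc n + 1) * of_nat (Suc n) powr (- Complex \<sigma> t)" for n
  define g where "g n = real (Suc n) powr (- \<sigma>)" for n
  have g: "summable g"
    unfolding g_def by (rule summable_Suc_powr_minus) fact
  have norm_f: "norm (f n) = g n" for n
    unfolding f_def g_def norm_mult norm_power norm_of_nat_powr_complex by simp
  then have f: "summable f"
    using g by (intro summable_norm_cancel[of f]) simp
  have "Re (dirichlet_eta (Complex \<sigma> t)) = Re (\<Sum>n. f n)"
    by (simp add: dirichlet_eta_def f_def)
  also have "(\<Sum>n. f n) = (\<Sum>n. f (n + 2)) + (f 0 + f 1)"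
    using suminf_split_initial_segment[OF f, of 2] by (simp add: numeral_2_eq_2)
  finally have eta: "Re (dirichlet_eta (Complex \<sigma> t))
      = Re (\<Sum>n. f (n + 2)) + 1 - 2 powr (- \<sigma>) * cos (t * ln 2)"
    using Re_two_powr_minus[of \<sigma> t] by (simp add: f_def)
  have "Re (riemann_zeta (complex_of_real \<sigma>)) = (\<Sum>n. g n)"
    using riemann_zeta_of_real[OF assms] by (simp add: g_def)
  also have "\<dots> = (\<Sum>n. g (n + 2)) + (g 0 + g 1)"
    using suminf_split_initial_segment[OF g, of 2] by (simp add: numeral_2_eq_2)
  finally have zeta: "(\<Sum>n. g (n + 2)) = Re (riemann_zeta (complex_of_real \<sigma>)) - 1 - 2 powr (- \<sigma>)"
    by (simp add: g_def)
  have "norm (\<Sum>n. f (n + 2)) \<le> (\<Sum>n. g (n + 2))"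
    using summable_norm[of "\<lambda>n. f (n + 2)"] g
    by (simp only: norm_f summable_iff_shift)
  then have "Re (\<Sum>n. f (n + 2)) \<ge> - (\<Sum>n. g (n + 2))"
    using abs_Re_le_cmod[of "\<Sum>n. f (n + 2)"] by linarith
  then show ?thesis
    using eta zeta by linarith
qed

theorem lemma2p3:
  fixes c \<sigma> t :: real
  assumes "c \<in> {0..<1}" and "\<sigma> > 1"
    and "- cos (t * ln 2) \<ge> 2 powr \<sigma> * Re (riemann_zeta (complex_of_real \<sigma>)) - 2 powr \<sigma> - 1"
  shows "dirichlet_eta (Complex \<sigma> t) - complex_of_real c \<noteq> 0"
proof
  assume "dirichlet_eta (Complex \<sigma> t) - complex_of_real c = 0"
  then have "Re (dirichlet_eta (Complex \<sigma> t)) < 1"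
    using assms(1) by simp
  moreover have "Re (riemann_zeta (complex_of_real \<sigma>)) - 1 - 2 powr (- \<sigma>)
      \<le> - (2 powr (- \<sigma>) * cos (t * ln 2))"
    using mult_left_mono[OF assms(3), of "2 powr (- \<sigma>)"] by (simp add: powr_minus algebra_simps)
  ultimately show False
    using Re_dirichlet_eta_ge[OF assms(2), of t] by linarith
qed

end
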